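(* Let $A$ be a unital $*$-ring which is not $*$-symmetric. Then for every integer $n>1$, the matrix ring $\mathbb M_n(A)$ with the $*$-transpose involution is not a Rickart $*$-ring.
   Context: A unital $*$-ring $A$ is $*$-symmetric if $1+xx^*$ is invertible for every $x\in A$. The $*$-transpose involution on $\mathbb M_n(A)$ is $(a_{ij})^*=(a_{ji}^* )$. A Rickart $*$-ring is a $*$-ring in which the right annihilator of every element is generated as a right ideal by a projection ($p=p^2=p^*$). *)

theory Defs
  imports "HOL-Analysis.Analysis"
begin

text \<open>Unital *-rings: unital (not necessarily commutative) rings with an involution
  that is additive, anti-multiplicative and of order two.\<close>
class star_ring = ring_1 +
  fixes star :: "'a \<Rightarrow> 'a"
  assumes star_add: "star (x + y) = star x + star y"
    and star_mult: "star (x * y) = star y * star x"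
    and star_star: "star (star x) = x"

text \<open>A unital *-ring is *-symmetric if 1 + x x* is (two-sided) invertible for every x.\<close>
definition star_symmetric :: "'a::star_ring itself \<Rightarrow> bool" where
  "star_symmetric _ \<longleftrightarrow>
     (\<forall>x::'a. \<exists>y. (1 + x * star x) * y = 1 \<and> y * (1 + x * star x) = 1)"

text \<open>The Rickart condition for a ring (carrier = whole type) with multiplication mul,
  zero z and involution st: the right annihilator of every element is the principal
  right ideal generated by a projection.\<close>
definition rickart_star :: "('b \<Rightarrow> 'b \<Rightarrow> 'b) \<Rightarrow> 'b \<Rightarrow> ('b \<Rightarrow> 'b) \<Rightarrow> bool" where
  "rickart_star mul z st \<longleftrightarrow>
     (\<forall>x. \<exists>p. mul p p = p \<and> st p = p \<and> {y. mul x y = z} = {mul p r | r. True})"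

text \<open>The *-transpose involution on square matrices over a *-ring.\<close>
definition mat_star :: "'a::star_ring ^'n^'n \<Rightarrow> 'a ^'n^'n" where
  "mat_star M = (\<chi> i j. star (M $ j $ i))"

end

theory Submission
  imports Defs
begin

text \<open>Pick y with 1 + y y* not invertible and put x = y*, so that 1 + x* x is not invertible.
  For indices a \<noteq> b let X be the matrix whose only nonzero row is row a, with entries 1 and x
  in columns a and b. A projection p generating the right annihilator of X satisfies X p = 0,
  and p Z = Z for every Z in that annihilator; taking for Z the column with entries -x and 1
  in rows a and b, these two equations and p = p* force q (1 + x* x) = 1 for the (b,b) entry q
  of p. Since q* = q, applying the involution gives (1 + x* x) q = 1 as well, a contradiction.\<close>

lemma star_zero [simp]: "star (0::'a::star_ring) = 0"
  using star_add[of "0::'a" 0] by simp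

lemma star_minus [simp]: "star (- x::'a::star_ring) = - star x"
proof -
  have "star x + star (- x) = 0"
    using star_add[of x "- x"] by simp
  then show ?thesis by (metis neg_eq_iff_add_eq_0)
qed

lemma star_one [simp]: "star (1::'a::star_ring) = 1"
  using star_mult[of "star 1" "1::'a"] by (simp add: star_star)

lemma inverse_of_selfadjoint_left_inverse:
  fixes q u :: "'a::star_ring"
  assumes "star q = q" and "star u = u" and "q * u = 1"
  shows "u * q = 1"
  using arg_cong[OF assms(3), of star] by (simp add: star_mult assms(1,2))

lemma rickart_star_annihilator_projection:
  assumes "rickart_star mul z st"
    and right_unit: "\<And>a. mul a e = a"
    and assoc: "\<And>a b c. mul (mul a b) c = mul a (mul b c)"
  obtains p where "st p = p" and "mul x p = z" and "\<And>y. mul x y = z \<Longrightarrow> mul p y = y"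
proof -
  obtain p where idem: "mul p p = p" and "st p = p"
    and ann: "{y. mul x y = z} = {mul p r | r. True}"
    using assms(1) unfolding rickart_star_def by blast
  have "mul x p = z"
    using ann right_unit[of p] by (metis (mono_tags, lifting) CollectD CollectI)
  moreover have "mul p y = y" if "mul x y = z" for y
  proof -
    from that ann obtain r where "y = mul p r" by blast
    then show ?thesis using idem assoc by metis
  qed
  ultimately show thesis using \<open>st p = p\<close> that by blast
qed

lemma mat_star_fixed_entry:
  assumes "mat_star M = M"
  shows "star (M $ j $ i) = M $ i $ j"
  using arg_cong[OF assms, of "\<lambda>N. N $ i $ j"] unfolding mat_star_def by simp

lemma sum_two_points_mult_left:
  fixes a b :: "'n::finite" and u v :: "'a::semiring_1"
  assumes "a \<noteq> b"
  shows "(\<Sum>k\<in>UNIV. (if k = a then u else if k = b then v else 0) * f k) = u * f a + v * f b"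
proof -
  have "(\<Sum>k\<in>UNIV. (if k = a then u else if k = b then v else 0) * f k)
      = (\<Sum>k\<in>UNIV. (if k = a then u * f a else 0) + (if k = b then v * f b else 0))"
    by (rule sum.cong) (use assms in auto)
  also have "\<dots> = u * f a + v * f b" by (simp add: sum.distrib)
  finally show ?thesis .
qed

lemma sum_two_points_mult_right:
  fixes a b :: "'n::finite" and u v :: "'a::semiring_1"
  assumes "a \<noteq> b"
  shows "(\<Sum>k\<in>UNIV. f k * (if k = a then u else if k = b then v else 0)) = f a * u + f b * v"
proof -
  have "(\<Sum>k\<in>UNIV. f k * (if k = a then u else if k = b then v else 0))
      = (\<Sum>k\<in>UNIV. (if k = a then f a * u else 0) + (if k = b then f b * v else 0))"
    by (rule sum.cong) (use assms in auto)
  also have "\<dots> = f a * u + f b * v" by (simp add: sum.distrib)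
  finally show ?thesis .
qed

definition two_entry_row :: "'n \<Rightarrow> 'n \<Rightarrow> 'a \<Rightarrow> 'a \<Rightarrow> 'a::zero^'n^'n" where
  "two_entry_row a b u v = (\<chi> i k. if i = a then (if k = a then u else if k = b then v else 0) else 0)"

definition two_entry_column :: "'n \<Rightarrow> 'n \<Rightarrow> 'a \<Rightarrow> 'a \<Rightarrow> 'a::zero^'n^'n" where
  "two_entry_column a b u v = (\<chi> k j. if j = a then (if k = a then u else if k = b then v else 0) else 0)"

lemma two_entry_row_mult_entry:
  fixes M :: "'a::semiring_1^'n::finite^'n"
  assumes "a \<noteq> b"
  shows "(two_entry_row a b u v ** M) $ i $ j = (if i = a then u * M $ a $ j + v * M $ b $ j else 0)"
  unfolding matrix_matrix_mult_def two_entry_row_def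
  using sum_two_points_mult_left[OF assms, of u v "\<lambda>k. M $ k $ j"] by simp

lemma mult_two_entry_column_entry:
  fixes M :: "'a::semiring_1^'n::finite^'n"
  assumes "a \<noteq> b"
  shows "(M ** two_entry_column a b u v) $ i $ j = (if j = a then M $ i $ a * u + M $ i $ b * v else 0)"
  unfolding matrix_matrix_mult_def two_entry_column_def
  using sum_two_points_mult_right[OF assms, of "\<lambda>k. M $ i $ k" u v] by simp

lemma two_entry_row_mult_column:
  fixes x :: "'a::ring_1"
  assumes "a \<noteq> b"
  shows "two_entry_row a b 1 x ** two_entry_column a b (- x) 1 = (0::'a^'n::finite^'n)"
  using assms by (simp add: vec_eq_iff two_entry_row_mult_entry two_entry_column_def)

lemma selfadjoint_annihilator_entry_left_inverse:
  fixes p :: "'a::star_ring^'n::finite^'n"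
  assumes "a \<noteq> b" and "mat_star p = p"
    and "two_entry_row a b 1 x ** p = 0"
    and "p ** two_entry_column a b (- x) 1 = two_entry_column a b (- x) 1"
  shows "p $ b $ b * (1 + star x * x) = 1"
proof -
  have "p $ a $ b + x * p $ b $ b = 0"
    using arg_cong[OF assms(3), of "\<lambda>M. M $ a $ b"] by (simp add: two_entry_row_mult_entry assms(1))
  then have "p $ a $ b = - (x * p $ b $ b)" by (simp add: eq_neg_iff_add_eq_0)
  then have "p $ b $ a = - (p $ b $ b * star x)"
    using mat_star_fixed_entry[OF assms(2)] by (metis star_minus star_mult)
  moreover have "p $ b $ a * (- x) + p $ b $ b * 1 = 1"
  proof -
    have "(p ** two_entry_column a b (- x) 1) $ b $ a = p $ b $ a * (- x) + p $ b $ b * 1"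
      by (simp add: mult_two_entry_column_entry[OF assms(1)])
    then show ?thesis
      using assms(1,4) by (simp add: two_entry_column_def)
  qed
  ultimately have "p $ b $ b * star x * x + p $ b $ b = 1"
    by simp
  then show ?thesis
    by (simp add: distrib_left mult.assoc add.commute)
qed

lemma matrix_ring_not_rickart_star:
  fixes x :: "'a::star_ring" and a b :: "'n::finite"
  assumes "a \<noteq> b"
    and not_inv: "\<not> (\<exists>q. (1 + star x * x) * q = 1 \<and> q * (1 + star x * x) = 1)"
  shows "\<not> rickart_star ((**) :: 'a^'n^'n \<Rightarrow> _) 0 mat_star"
proof
  assume "rickart_star ((**) :: 'a^'n^'n \<Rightarrow> _) 0 mat_star"
  then obtain p :: "'a^'n^'n" where sa: "mat_star p = p"
    and ann: "two_entry_row a b 1 x ** p = 0"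
    and gen: "\<And>Y :: 'a^'n^'n. two_entry_row a b 1 x ** Y = 0 \<Longrightarrow> p ** Y = Y"
    by (rule rickart_star_annihilator_projection[OF _ matrix_mul_rid matrix_mul_assoc[symmetric],
          where x = "two_entry_row a b 1 x"]) blast
  have left: "p $ b $ b * (1 + star x * x) = 1"
    using selfadjoint_annihilator_entry_left_inverse[OF assms(1) sa ann
        gen[OF two_entry_row_mult_column[OF assms(1)]]] .
  have "star (p $ b $ b) = p $ b $ b"
    using mat_star_fixed_entry[OF sa] .
  moreover have "star (1 + star x * x) = 1 + star x * x"
    by (simp add: star_add star_mult star_star)
  ultimately have "(1 + star x * x) * p $ b $ b = 1"
    using inverse_of_selfadjoint_left_inverse left by blast
  with left not_inv show False by blast
qed

theorem mainTheorem18: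
  assumes "\<not> star_symmetric TYPE('a::star_ring)"
    and "CARD('n::finite) > 1"
  shows "\<not> rickart_star
           ((**) :: 'a ^'n^'n \<Rightarrow> 'a ^'n^'n \<Rightarrow> 'a ^'n^'n) 0 (mat_star :: 'a ^'n^'n \<Rightarrow> _)"
proof -
  obtain y :: 'a where "\<not> (\<exists>q. (1 + y * star y) * q = 1 \<and> q * (1 + y * star y) = 1)"
    using assms(1) unfolding star_symmetric_def by blast
  then have not_inv: "\<not> (\<exists>q. (1 + star (star y) * star y) * q = 1 \<and> q * (1 + star (star y) * star y) = 1)"
    by (simp add: star_star)
  have "\<not> (\<forall>a\<in>UNIV. \<forall>b\<in>UNIV. a = (b::'n))"
    using assms(2) card_le_Suc0_iff_eq[of "UNIV :: 'n set"] by simp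
  then obtain a b :: 'n where "a \<noteq> b"
    by blast
  then show ?thesis
    using matrix_ring_not_rickart_star[OF _ not_inv] by blast
qed

end
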